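(* Let $\{G_i\}_{i\in I}$ be an HS-frame for $\mathcal{H}$ with respect to $\mathcal{K}$ with bounds $A,B$, and let $\{H_i\}_{i\in I}$ be a family of bounded linear operators from $\mathcal{H}$ into $\mathcal{C}_2(\mathcal{K})$. Suppose that for each real $k>0$ there exist constants $\lambda_1,\lambda_2\geq 0$ (which may depend on $k$) satisfying $\max\{\lambda_1,\lambda_2\}<\min\{1,2^{k-1}\}$ such that for every finite subset $J\subseteq I$ and every $x\in\mathcal{H}$, $$\Big\|\sum_{i\in J}(G_i^*G_i x-H_i^*H_i x)\Big\|^k\leq\lambda_1\Big\|\sum_{i\in J}G_i^*G_i x\Big\|^k+\lambda_2\Big\|\sum_{i\in J}H_i^*H_i x\Big\|^k.$$ Then $\{H_i\}_{i\in I}$ is an HS-frame for $\mathcal{H}$ with respect to $\mathcal{K}$, and for each $k>0$, with the corresponding constants $\lambda_1,\lambda_2$, it has (lower and upper, respectively) frame bounds $$A\left(\frac{1-c^{1/k}\lambda_1^{1/k}}{1+c^{1/k}\lambda_2^{1/k}}\right)\quad\text{and}\quad B\left(\frac{1+c^{1/k}\lambda_1^{1/k}}{1-c^{1/k}\lambda_2^{1/k}}\right),$$ where $c=1$ if $k\geq 1$ and $c=2^{1-k}$ if $k\leq 1$.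
   Context: $\mathcal{H}$ and $\mathcal{K}$ are separable Hilbert spaces and $I$ is a countable index set. $\mathcal{C}_2(\mathcal{K})$ is the Hilbert-Schmidt class: all compact operators $T$ on $\mathcal{K}$ with $\sum_j\|Te_j\|^2<\infty$, where $\{e_j\}$ is an orthonormal basis of $\mathcal{K}$; it is a Hilbert space with inner product $[T,S]_{\mathrm{tr}}=\mathrm{trace}(S^*T)=\sum_j\langle Te_j,Se_j\rangle$ and norm $\|T\|_2=[T,T]_{\mathrm{tr}}^{1/2}$. For a bounded linear operator $G:\mathcal{H}\to\mathcal{C}_2(\mathcal{K})$, the adjoint $G^*:\mathcal{C}_2(\mathcal{K})\to\mathcal{H}$ is determined by $[Gx,T]_{\mathrm{tr}}=\langle x,G^*T\rangle$ for all $x\in\mathcal{H}$, $T\in\mathcal{C}_2(\mathcal{K})$. A family $\{G_i\}_{i\in I}$ of bounded linear operators from $\mathcal{H}$ into $\mathcal{C}_2(\mathcal{K})$ is a Hilbert-Schmidt frame (HS-frame) for $\mathcal{H}$ with respect to $\mathcal{K}$ with (frame) bounds $A,B$ if $A,B>0$ and $$A\|x\|^2\leq\sum_{i\in I}\|G_ix\|_2^2\leq B\|x\|^2\quad\text{for all }x\in\mathcal{H};$$ $A$ is the lower and $B$ the upper frame bound (bounds are not required to be optimal). *)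

theory Defs
  imports "HOL-Analysis.Analysis"
begin

section \<open>Complex Hilbert spaces\<close>

class complex_vector = real_vector +
  fixes scaleC :: "complex \<Rightarrow> 'a \<Rightarrow> 'a"  (infixr \<open>*\<^sub>C\<close> 75)
  assumes scaleC_add_right: "a *\<^sub>C (x + y) = a *\<^sub>C x + a *\<^sub>C y"
    and scaleC_add_left: "(a + b) *\<^sub>C x = a *\<^sub>C x + b *\<^sub>C x"
    and scaleC_scaleC: "a *\<^sub>C b *\<^sub>C x = (a * b) *\<^sub>C x"
    and scaleR_scaleC: "r *\<^sub>R x = complex_of_real r *\<^sub>C x"

lemma scaleC_one [simp]: "1 *\<^sub>C (x::'a::complex_vector) = x"
  by (metis of_real_1 scaleR_one scaleR_scaleC)

interpretation complex_vector: vector_space "scaleC :: complex \<Rightarrow> 'a \<Rightarrow> 'a::complex_vector"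
  by unfold_locales (simp_all add: scaleC_add_right scaleC_add_left scaleC_scaleC)

text \<open>
  The inner product is linear in its first and conjugate-linear in its second argument.
  Building on \<^class>\<open>real_inner\<close>, whose inner product is the real part, makes the norm
  and the topology the ones of the library: \<open>(norm x)\<^sup>2 = Re (cinner x x)\<close>.
\<close>

class complex_inner = complex_vector + real_inner +
  fixes cinner :: "'a \<Rightarrow> 'a \<Rightarrow> complex"
  assumes cinner_commute: "cinner x y = cnj (cinner y x)"
    and cinner_add_left: "cinner (x + y) z = cinner x z + cinner y z"
    and cinner_scaleC_left: "cinner (a *\<^sub>C x) y = a * cinner x y"
    and inner_eq_Re_cinner: "inner x y = Re (cinner x y)"

text \<open>A separable Hilbert space: complete, with countable base of the (metric) topology.\<close>

class separable_hilbert = complex_inner + polish_space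

instantiation complex :: separable_hilbert
begin
definition scaleC_complex :: "complex \<Rightarrow> complex \<Rightarrow> complex"
  where "scaleC_complex a x = a * x"
definition cinner_complex :: "complex \<Rightarrow> complex \<Rightarrow> complex"
  where "cinner_complex x y = x * cnj y"
instance
  by intro_classes
    (auto simp: scaleC_complex_def cinner_complex_def algebra_simps inner_complex_def scaleR_conv_of_real)
end

lemma cinner_add_right: "cinner x (y + z) = cinner x y + cinner x (z::'a::complex_inner)"
  by (metis cinner_add_left cinner_commute complex_cnj_add)

lemma cinner_scaleC_right: "cinner x (a *\<^sub>C y) = cnj a * cinner x (y::'a::complex_inner)"
  by (metis cinner_scaleC_left cinner_commute complex_cnj_mult)

lemma cinner_zero_left [simp]: "cinner 0 (x::'a::complex_inner) = 0"
  using cinner_add_left[of 0 0 x] by simp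

lemma cinner_zero_right [simp]: "cinner (x::'a::complex_inner) 0 = 0"
  using cinner_add_right[of x 0 0] by simp

lemma cinner_diff_left: "cinner (x - y) z = cinner x z - cinner y (z::'a::complex_inner)"
  using cinner_add_left[of "x - y" y z] by simp

lemma cinner_sum_left: "cinner (sum f A) (z::'a::complex_inner) = (\<Sum>a\<in>A. cinner (f a) z)"
  by (induction A rule: infinite_finite_induct) (auto simp: cinner_add_left)

lemma cinner_self: "cinner x (x::'a::complex_inner) = complex_of_real ((norm x)\<^sup>2)"
proof -
  have "Im (cinner x x) = 0"
    using arg_cong[OF cinner_commute[of x x], of Im] by simp
  moreover have "Re (cinner x x) = (norm x)\<^sup>2"
    by (simp add: inner_eq_Re_cinner[symmetric] power2_norm_eq_inner)
  ultimately show ?thesis by (simp add: complex_eq_iff)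
qed

lemma norm_scaleC: "norm (a *\<^sub>C (x::'a::complex_inner)) = cmod a * norm x"
proof -
  have "complex_of_real ((norm (a *\<^sub>C x))\<^sup>2) = cinner (a *\<^sub>C x) (a *\<^sub>C x)"
    by (rule cinner_self[symmetric])
  also have "\<dots> = (a * cnj a) * cinner x x"
    by (simp add: cinner_scaleC_left cinner_scaleC_right)
  also have "\<dots> = complex_of_real ((cmod a * norm x)\<^sup>2)"
    by (simp only: complex_norm_square[symmetric] cinner_self power_mult_distrib of_real_mult)
  finally have "complex_of_real ((norm (a *\<^sub>C x))\<^sup>2) = complex_of_real ((cmod a * norm x)\<^sup>2)" .
  then show ?thesis
    by (simp only: of_real_eq_iff) (simp add: power2_eq_iff_nonneg)
qed

lemma Im_cinner: "Im (cinner x y) = - inner (\<i> *\<^sub>C x) (y::'a::complex_inner)"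
  by (simp add: inner_eq_Re_cinner cinner_scaleC_left)

lemma norm_cinner_le: "norm (cinner x (y::'a::complex_inner)) \<le> (norm x)\<^sup>2 + (norm y)\<^sup>2"
proof -
  have "norm (cinner x y) \<le> \<bar>Re (cinner x y)\<bar> + \<bar>Im (cinner x y)\<bar>"
    by (rule cmod_le)
  also have "\<dots> \<le> norm x * norm y + norm (\<i> *\<^sub>C x) * norm y"
    unfolding Im_cinner inner_eq_Re_cinner[symmetric] abs_minus_cancel
    by (intro add_mono Cauchy_Schwarz_ineq2)
  also have "\<dots> = 2 * norm x * norm y" by (simp add: norm_scaleC)
  also have "\<dots> \<le> (norm x)\<^sup>2 + (norm y)\<^sup>2" by (rule sum_squares_bound)
  finally show ?thesis .
qed

section \<open>Bounded operators, adjoints and orthonormal bases\<close>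

definition bounded_clinear :: "('a::complex_inner \<Rightarrow> 'b::complex_inner) \<Rightarrow> bool"
  where "bounded_clinear T \<longleftrightarrow> bounded_linear T \<and> (\<forall>a x. T (a *\<^sub>C x) = a *\<^sub>C T x)"

text \<open>The adjoint exists (and is unique) for bounded operators with complete domain.\<close>

definition cadjoint :: "('a::complex_inner \<Rightarrow> 'b::complex_inner) \<Rightarrow> 'b \<Rightarrow> 'a"
  where "cadjoint G = (THE F. \<forall>x y. cinner (G x) y = cinner x (F y))"

definition compact_operator :: "('a::complex_inner \<Rightarrow> 'b::complex_inner) \<Rightarrow> bool"
  where "compact_operator T \<longleftrightarrow> bounded_clinear T \<and> compact (closure (T ` cball 0 1))"

definition orthonormal :: "'a::complex_inner set \<Rightarrow> bool"
  where "orthonormal E \<longleftrightarrow> (\<forall>e\<in>E. norm e = 1) \<and> (\<forall>e\<in>E. \<forall>f\<in>E. e \<noteq> f \<longrightarrow> cinner e f = 0)"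

definition orthonormal_basis :: "'a::complex_inner set \<Rightarrow> bool"
  where "orthonormal_basis E \<longleftrightarrow> orthonormal E \<and> closure (complex_vector.span E) = UNIV"

text \<open>Gram--Schmidt orthonormalization of a sequence\<close>

fun gram_schmidt :: "(nat \<Rightarrow> 'a::complex_inner) \<Rightarrow> nat \<Rightarrow> 'a set" where
  "gram_schmidt d 0 = {}"
| "gram_schmidt d (Suc n) =
    (let r = d n - (\<Sum>e\<in>gram_schmidt d n. cinner (d n) e *\<^sub>C e)
     in if r = 0 then gram_schmidt d n else insert ((1 / norm r) *\<^sub>R r) (gram_schmidt d n))"

lemma gram_schmidt_invariant:
  "finite (gram_schmidt d n) \<and> orthonormal (gram_schmidt d n) \<and>
    (\<forall>m<n. d m \<in> complex_vector.span (gram_schmidt d n))"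
proof (induction n)
  case 0
  then show ?case by (simp add: orthonormal_def)
next
  case (Suc n)
  define E where "E = gram_schmidt d n"
  define p where "p = (\<Sum>e\<in>E. cinner (d n) e *\<^sub>C e)"
  define r where "r = d n - p"
  have E: "finite E" "orthonormal E" "\<And>m. m < n \<Longrightarrow> d m \<in> complex_vector.span E"
    using Suc unfolding E_def by auto
  have p: "p \<in> complex_vector.span E"
    unfolding p_def
    by (intro complex_vector.span_sum complex_vector.span_scale complex_vector.span_base)
  show ?case
  proof (cases "r = 0")
    case True
    then have "gram_schmidt d (Suc n) = E" "d n = p"
      by (simp_all add: E_def p_def r_def)
    with E p show ?thesis by (auto simp: less_Suc_eq)
  next
    case False
    define u where "u = (1 / norm r) *\<^sub>R r"
    have eq: "gram_schmidt d (Suc n) = insert u E"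
      using False by (simp add: E_def p_def r_def u_def Let_def)
    have orth: "cinner r f = 0" if f: "f \<in> E" for f
    proof -
      have "cinner p f = (\<Sum>e\<in>E. cinner (d n) e * cinner e f)"
        by (simp add: p_def cinner_sum_left cinner_scaleC_left)
      also have "\<dots> = (\<Sum>e\<in>E. if e = f then cinner (d n) f else 0)"
        using E(2) f by (intro sum.cong) (auto simp: orthonormal_def cinner_self)
      also have "\<dots> = cinner (d n) f" using E(1) f by simp
      finally show ?thesis by (simp add: r_def cinner_diff_left)
    qed
    have uf: "cinner u f = 0" if "f \<in> E" for f
      using orth[OF that] by (simp add: u_def scaleR_scaleC cinner_scaleC_left)
    have fu: "cinner f u = 0" if "f \<in> E" for f
      using uf[OF that] by (subst cinner_commute) simp
    have nu: "norm u = 1" using False by (simp add: u_def)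
    have "r = complex_of_real (norm r) *\<^sub>C u"
      using False by (simp add: u_def flip: scaleR_scaleC)
    then have "r \<in> complex_vector.span (insert u E)"
      by (metis complex_vector.span_base complex_vector.span_scale insertI1)
    moreover have mono: "complex_vector.span E \<subseteq> complex_vector.span (insert u E)"
      by (rule complex_vector.span_mono) auto
    ultimately have "r + p \<in> complex_vector.span (insert u E)"
      using p by (intro complex_vector.span_add) auto
    then have "d n \<in> complex_vector.span (insert u E)" by (simp add: r_def)
    then show ?thesis
      using E uf fu nu mono unfolding eq by (auto simp: orthonormal_def less_Suc_eq)
  qed
qed

lemma gram_schmidt_mono: "m \<le> n \<Longrightarrow> gram_schmidt d m \<subseteq> gram_schmidt d n"
  by (rule lift_Suc_mono_le[of "gram_schmidt d"]) (auto simp: Let_def)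

lemma orthonormal_basis_exists: "\<exists>E :: 'a::separable_hilbert set. orthonormal_basis E"
proof -
  obtain D :: "'a set" where D: "countable D" "\<And>X. open X \<Longrightarrow> X \<noteq> {} \<Longrightarrow> \<exists>d\<in>D. d \<in> X"
    using countable_dense_setE by blast
  have "D \<noteq> {}" using D(2)[of UNIV] by auto
  then obtain d where d: "D = range (d :: nat \<Rightarrow> 'a)"
    using D(1) by (metis uncountable_def)
  define E where "E = (\<Union>n. gram_schmidt d n)"
  have "orthonormal E"
    unfolding orthonormal_def
  proof (intro conjI ballI impI)
    fix e assume "e \<in> E"
    then show "norm e = 1"
      using gram_schmidt_invariant[of d] by (auto simp: E_def orthonormal_def)
  next
    fix e f assume "e \<in> E" "f \<in> E" and ne: "e \<noteq> f"
    then obtain m n where "e \<in> gram_schmidt d m" "f \<in> gram_schmidt d n"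
      by (auto simp: E_def)
    then have "e \<in> gram_schmidt d (max m n)" "f \<in> gram_schmidt d (max m n)"
      using gram_schmidt_mono[of m "max m n" d] gram_schmidt_mono[of n "max m n" d] by auto
    then show "cinner e f = 0"
      using gram_schmidt_invariant[of d "max m n"] ne by (auto simp: orthonormal_def)
  qed
  moreover have "D \<subseteq> complex_vector.span E"
  proof
    fix x assume "x \<in> D"
    then obtain n where "x = d n" using d by auto
    then have "x \<in> complex_vector.span (gram_schmidt d (Suc n))"
      using gram_schmidt_invariant[of d "Suc n"] by auto
    then show "x \<in> complex_vector.span E"
      using complex_vector.span_mono[of "gram_schmidt d (Suc n)" E] unfolding E_def by blast
  qed
  moreover have "closure D = UNIV"
  proof -
    have "- closure D = {}"
    proof (rule ccontr)
      assume "- closure D \<noteq> {}"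
      then obtain y where "y \<in> D" "y \<in> - closure D" using D(2)[of "- closure D"] by auto
      then show False using closure_subset[of D] by auto
    qed
    then show ?thesis by auto
  qed
  ultimately show ?thesis
    unfolding orthonormal_basis_def by (metis closure_mono top.extremum_uniqueI)
qed

section \<open>The Hilbert--Schmidt class\<close>

text \<open>
  The Hilbert--Schmidt class, its inner product and its norm are given by a fixed orthonormal
  basis of the underlying space; they do not depend on its choice.
\<close>

definition some_basis :: "'a::separable_hilbert set"
  where "some_basis = (SOME E. orthonormal_basis E)"

lemma orthonormal_basis_some_basis: "orthonormal_basis some_basis"
  unfolding some_basis_def by (rule someI_ex[OF orthonormal_basis_exists])

lemma compact_closure_subset:
  fixes S :: "'a::real_normed_vector set"
  assumes "compact K" "S \<subseteq> K"
  shows "compact (closure S)"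
proof -
  have "closure S \<subseteq> K"
    using assms by (intro closure_minimal compact_imp_closed)
  then have "K \<inter> closure S = closure S" by auto
  then show ?thesis using compact_Int_closed[OF assms(1) closed_closure[of S]] by simp
qed

lemma compact_operator_zero: "compact_operator (\<lambda>x. 0)"
  unfolding compact_operator_def bounded_clinear_def
  by (auto intro: compact_closure_subset[of "{0}"])

lemma compact_operator_add:
  assumes "compact_operator S" "compact_operator T"
  shows "compact_operator (\<lambda>x. S x + T x)"
proof -
  let ?K = "{x + y |x y. x \<in> closure (S ` cball 0 1) \<and> y \<in> closure (T ` cball 0 1)}"
  have "compact ?K"
    using assms by (intro compact_sums) (auto simp: compact_operator_def)
  moreover have "(\<lambda>x. S x + T x) ` cball 0 1 \<subseteq> ?K"
    using closure_subset[of "S ` cball 0 1"] closure_subset[of "T ` cball 0 1"] by blast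
  ultimately have "compact (closure ((\<lambda>x. S x + T x) ` cball 0 1))"
    by (rule compact_closure_subset)
  then show ?thesis
    using assms unfolding compact_operator_def bounded_clinear_def
    by (auto intro: bounded_linear_add simp: scaleC_add_right)
qed

lemma bounded_linear_scaleC: "bounded_linear (\<lambda>x::'a::complex_inner. a *\<^sub>C x)"
  by (rule bounded_linear_intro[where K="cmod a"])
    (auto simp: scaleC_add_right scaleR_scaleC scaleC_scaleC norm_scaleC mult.commute)

lemma compact_operator_scaleC:
  assumes "compact_operator T"
  shows "compact_operator (\<lambda>x. a *\<^sub>C T x)"
proof -
  let ?K = "(\<lambda>x. a *\<^sub>C x) ` closure (T ` cball 0 1)"
  have "compact ?K"
    using assms by (intro compact_continuous_image)
      (auto simp: compact_operator_def intro: linear_continuous_on bounded_linear_scaleC)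
  moreover have "(\<lambda>x. a *\<^sub>C T x) ` cball 0 1 \<subseteq> ?K"
    using closure_subset[of "T ` cball 0 1"] by blast
  ultimately have "compact (closure ((\<lambda>x. a *\<^sub>C T x) ` cball 0 1))"
    by (rule compact_closure_subset)
  then show ?thesis
    using assms unfolding compact_operator_def bounded_clinear_def
    by (auto intro: bounded_linear_compose[OF bounded_linear_scaleC] simp: scaleC_scaleC mult.commute)
qed

typedef (overloaded) 'k hs_op =
  "{T :: 'k::separable_hilbert \<Rightarrow> 'k.
      compact_operator T \<and> (\<lambda>e. (norm (T e))\<^sup>2) summable_on some_basis}"
  morphisms hs_apply Abs_hs_op
  by (rule exI[of _ "\<lambda>x. 0"]) (simp add: compact_operator_zero)

setup_lifting type_definition_hs_op

instantiation hs_op :: (separable_hilbert) complex_vector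
begin

lift_definition zero_hs_op :: "'a hs_op" is "\<lambda>x. 0"
  by (simp add: compact_operator_zero)

lift_definition scaleC_hs_op :: "complex \<Rightarrow> 'a hs_op \<Rightarrow> 'a hs_op" is "\<lambda>a T x. a *\<^sub>C T x"
  by (auto intro: compact_operator_scaleC summable_on_cmult_right
      simp: norm_scaleC power_mult_distrib)

lift_definition plus_hs_op :: "'a hs_op \<Rightarrow> 'a hs_op \<Rightarrow> 'a hs_op" is "\<lambda>S T x. S x + T x"
proof (intro conjI; (elim conjE)?)
  fix S T :: "'a \<Rightarrow> 'a"
  assume "compact_operator S" "compact_operator T"
  then show "compact_operator (\<lambda>x. S x + T x)" by (rule compact_operator_add)
next
  fix S T :: "'a \<Rightarrow> 'a"
  assume "(\<lambda>e. (norm (S e))\<^sup>2) summable_on some_basis" "(\<lambda>e. (norm (T e))\<^sup>2) summable_on some_basis"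
  then have "(\<lambda>e. 2 * ((norm (S e))\<^sup>2 + (norm (T e))\<^sup>2)) summable_on some_basis"
    by (intro summable_on_cmult_right summable_on_add)
  moreover have "(norm (S e + T e))\<^sup>2 \<le> 2 * ((norm (S e))\<^sup>2 + (norm (T e))\<^sup>2)" for e
  proof -
    have "(norm (S e + T e))\<^sup>2 \<le> (norm (S e) + norm (T e))\<^sup>2"
      by (intro power_mono norm_triangle_ineq) auto
    also have "\<dots> \<le> 2 * ((norm (S e))\<^sup>2 + (norm (T e))\<^sup>2)"
      using sum_squares_bound[of "norm (S e)" "norm (T e)"] by (simp add: power2_sum)
    finally show ?thesis .
  qed
  ultimately show "(\<lambda>e. (norm (S e + T e))\<^sup>2) summable_on some_basis"
    by (rule summable_on_comparison_test) auto
qed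

definition uminus_hs_op :: "'a hs_op \<Rightarrow> 'a hs_op" where "uminus_hs_op T = (- 1) *\<^sub>C T"
definition minus_hs_op :: "'a hs_op \<Rightarrow> 'a hs_op \<Rightarrow> 'a hs_op" where "minus_hs_op S T = S + (- T)"
definition scaleR_hs_op :: "real \<Rightarrow> 'a hs_op \<Rightarrow> 'a hs_op"
  where "scaleR_hs_op r T = complex_of_real r *\<^sub>C T"

instance
proof
  fix S T U :: "'a hs_op" and a b :: complex and r s :: real
  show "S + T + U = S + (T + U)" by transfer (simp add: add.assoc)
  show "S + T = T + S" by transfer (simp add: add.commute)
  show "0 + S = S" by transfer simp
  show "- S + S = 0" unfolding uminus_hs_op_def by transfer simp
  show "S - T = S + - T" by (simp add: minus_hs_op_def)
  show "r *\<^sub>R (S + T) = r *\<^sub>R S + r *\<^sub>R T"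
    unfolding scaleR_hs_op_def by transfer (simp add: scaleC_add_right)
  show "(r + s) *\<^sub>R S = r *\<^sub>R S + s *\<^sub>R S"
    unfolding scaleR_hs_op_def by transfer (simp add: scaleC_add_left)
  show "r *\<^sub>R s *\<^sub>R S = (r * s) *\<^sub>R S"
    unfolding scaleR_hs_op_def by transfer (simp add: scaleC_scaleC)
  show "1 *\<^sub>R S = S" unfolding scaleR_hs_op_def by transfer simp
  show "a *\<^sub>C (S + T) = a *\<^sub>C S + a *\<^sub>C T" by transfer (simp add: scaleC_add_right)
  show "(a + b) *\<^sub>C S = a *\<^sub>C S + b *\<^sub>C S" by transfer (simp add: scaleC_add_left)
  show "a *\<^sub>C b *\<^sub>C S = (a * b) *\<^sub>C S" by transfer (simp add: scaleC_scaleC)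
  show "r *\<^sub>R S = complex_of_real r *\<^sub>C S" by (simp add: scaleR_hs_op_def)
qed

end

lemma hs_summable_norm: "(\<lambda>e. (norm (hs_apply T e))\<^sup>2) summable_on some_basis"
  using hs_apply[of T] by auto

lemma hs_summable_cinner:
  "(\<lambda>e. cinner (hs_apply S e) (hs_apply T e)) summable_on some_basis"
proof -
  have "(\<lambda>e. norm (cinner (hs_apply S e) (hs_apply T e))) summable_on some_basis"
    by (rule summable_on_comparison_test[OF summable_on_add[OF hs_summable_norm hs_summable_norm]])
      (auto intro: norm_cinner_le)
  then show ?thesis by (rule abs_summable_summable)
qed

lemma bounded_linear_zero_on_basis:
  assumes T: "bounded_clinear T" and E: "orthonormal_basis E" and 0: "\<And>e. e \<in> E \<Longrightarrow> T e = 0"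
  shows "T x = 0"
proof -
  have lin: "bounded_linear T" using T by (simp add: bounded_clinear_def)
  have "T y = 0" if "y \<in> complex_vector.span E" for y
    using that
  proof (induction rule: complex_vector.span_induct_alt)
    case base
    then show ?case using lin by (simp add: linear_simps)
  next
    case (step c e y)
    then show ?case using lin T 0 by (simp add: linear_simps bounded_clinear_def)
  qed
  then have "complex_vector.span E \<subseteq> {y. T y = 0}" by auto
  moreover have "closed {y. T y = 0}"
    using lin by (intro closed_Collect_eq) (auto intro: linear_continuous_on)
  ultimately have "closure (complex_vector.span E) \<subseteq> {y. T y = 0}"
    by (rule closure_minimal)
  then show ?thesis using E by (auto simp: orthonormal_basis_def)
qed

instantiation hs_op :: (separable_hilbert) complex_inner
begin

definition cinner_hs_op :: "'a hs_op \<Rightarrow> 'a hs_op \<Rightarrow> complex"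
  where "cinner_hs_op T S = (\<Sum>\<^sub>\<infinity>e\<in>some_basis. cinner (hs_apply T e) (hs_apply S e))"

definition inner_hs_op :: "'a hs_op \<Rightarrow> 'a hs_op \<Rightarrow> real"
  where "inner_hs_op T S = Re (cinner T S)"

definition norm_hs_op :: "'a hs_op \<Rightarrow> real"
  where "norm_hs_op T = sqrt (inner T T)"

definition sgn_hs_op :: "'a hs_op \<Rightarrow> 'a hs_op"
  where "sgn_hs_op T = T /\<^sub>R norm T"

definition dist_hs_op :: "'a hs_op \<Rightarrow> 'a hs_op \<Rightarrow> real"
  where "dist_hs_op S T = norm (S - T)"

definition uniformity_hs_op :: "('a hs_op \<times> 'a hs_op) filter"
  where "uniformity_hs_op = (INF e\<in>{0<..}. principal {(x, y). dist x y < e})"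

definition open_hs_op :: "'a hs_op set \<Rightarrow> bool"
  where "open_hs_op U = (\<forall>x\<in>U. eventually (\<lambda>(x', y). x' = x \<longrightarrow> y \<in> U) uniformity)"

instance
proof
  fix S T U :: "'a hs_op" and a :: complex and r :: real
  show comm: "cinner S T = cnj (cinner T S)" for S T :: "'a hs_op"
    unfolding cinner_hs_op_def infsum_cnj[symmetric] by (simp add: cinner_commute[symmetric])
  show add: "cinner (S + T) U = cinner S U + cinner T U"
    unfolding cinner_hs_op_def
    by (subst infsum_add[symmetric])
      (auto intro: hs_summable_cinner simp: plus_hs_op.rep_eq cinner_add_left)
  show scale: "cinner (a *\<^sub>C S) T = a * cinner S T" for a and S T :: "'a hs_op"
    unfolding cinner_hs_op_def
    by (subst infsum_cmult_right'[symmetric])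
      (simp add: scaleC_hs_op.rep_eq cinner_scaleC_left)
  show "inner S T = Re (cinner S T)" by (simp add: inner_hs_op_def)
  show "inner S T = inner T S" by (subst inner_hs_op_def, subst comm) (simp add: inner_hs_op_def)
  show "inner (S + T) U = inner S U + inner T U" by (simp add: inner_hs_op_def add)
  show "inner (r *\<^sub>R S) T = r * inner S T"
    by (simp add: inner_hs_op_def scaleR_hs_op_def scale)
  have inner_self: "inner S S = (\<Sum>\<^sub>\<infinity>e\<in>some_basis. (norm (hs_apply S e))\<^sup>2)"
    unfolding inner_hs_op_def cinner_hs_op_def
    by (subst infsum_Re[symmetric, OF hs_summable_cinner]) (simp add: cinner_self)
  show "0 \<le> inner S S" unfolding inner_self by (rule infsum_nonneg) auto
  show "inner S S = 0 \<longleftrightarrow> S = 0"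
  proof
    assume "inner S S = 0"
    then have "hs_apply S e = 0" if "e \<in> some_basis" for e
      using nonneg_infsum_le_0D[OF _ hs_summable_norm _ that, of S] by (simp add: inner_self)
    then have "hs_apply S x = 0" for x
      using bounded_linear_zero_on_basis[OF _ orthonormal_basis_some_basis] hs_apply[of S]
      by (auto simp: compact_operator_def)
    then show "S = 0" by transfer auto
  next
    assume "S = 0"
    then show "inner S S = 0" by (subst inner_self) (simp add: zero_hs_op.rep_eq)
  qed
  show "norm S = sqrt (inner S S)" by (simp add: norm_hs_op_def)
  show "sgn S = S /\<^sub>R norm S" by (simp add: sgn_hs_op_def)
  show "dist S T = norm (S - T)" by (simp add: dist_hs_op_def)
  show "uniformity = (INF e\<in>{0<..}. principal {(x, y). dist x (y::'a hs_op) < e})"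
    by (simp add: uniformity_hs_op_def)
  show "open W = (\<forall>x\<in>W. eventually (\<lambda>(x', y). x' = x \<longrightarrow> y \<in> W) uniformity)" for W :: "'a hs_op set"
    by (simp add: open_hs_op_def)
qed

end

section \<open>Hilbert--Schmidt frames\<close>

text \<open>
  Summability is required separately because the infinite sum of a non-summable family is 0.
\<close>

definition hs_frame ::
  "'i set \<Rightarrow> ('i \<Rightarrow> 'h::separable_hilbert \<Rightarrow> 'k::separable_hilbert hs_op) \<Rightarrow> real \<Rightarrow> real \<Rightarrow> bool"
  where "hs_frame I G A B \<longleftrightarrow>
    (\<forall>i\<in>I. bounded_clinear (G i)) \<and> 0 < A \<and> 0 < B \<and>
    (\<forall>x. (\<lambda>i. (norm (G i x))\<^sup>2) summable_on I \<and>
         A * (norm x)\<^sup>2 \<le> (\<Sum>\<^sub>\<infinity>i\<in>I. (norm (G i x))\<^sup>2) \<and>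
         (\<Sum>\<^sub>\<infinity>i\<in>I. (norm (G i x))\<^sup>2) \<le> B * (norm x)\<^sup>2)"

end

theory Submission
  imports Defs
begin

text \<open>
  Write \<open>S J\<close> and \<open>T J\<close> for the sums of \<open>G\<^sub>i\<^sup>* G\<^sub>i\<close> and \<open>H\<^sub>i\<^sup>* H\<^sub>i\<close> over a finite set \<open>J\<close>. Elementary
  inequalities for \<open>z powr k\<close> turn the hypothesis with exponent \<open>k\<close> into the linear estimate
  \<open>norm (S J x - T J x) \<le> a * norm (S J x) + b * norm (T J x)\<close>, where
  \<open>a\<close> and \<open>b\<close> are the \<open>k\<close>-th roots of \<open>c \<lambda>\<^sub>1\<close> and \<open>c \<lambda>\<^sub>2\<close>, both less than 1 (\<open>powr_root_le\<close>).
  For each \<open>k\<close> the claim thus follows from the case of linear estimates, \<open>hs_frame_perturbation\<close>.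
  There the triangle inequality gives
  \<open>p * norm (S J x) \<le> norm (T J x) \<le> q * norm (S J x)\<close> with
  \<open>p = (1 - a) / (1 + b)\<close> and \<open>q = (1 + a) / (1 - b)\<close>.

  The upper bound follows from \<open>norm (S J x) \<le> B * norm x\<close> and
  \<open>(\<Sum>i\<in>J. (norm (H i x))\<^sup>2) = inner x (T J x) \<le> norm x * norm (T J x)\<close>, uniformly in \<open>J\<close>.

  The lower bound is subtler: in the limit \<open>T\<close> of the \<open>T J\<close>, the left-hand estimate controls the
  norm of \<open>T x\<close> from below, whereas a lower bound for \<open>inner x (T x)\<close> is wanted. For a positive
  operator the second follows from the first. At unit vectors where the quadratic form is nearly
  minimal, with infimum \<open>\<mu>\<close>, Cauchy--Schwarz for the positive form of \<open>T - \<mu>\<close> shows that \<open>T x\<close> is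
  nearly \<open>\<mu> x\<close>; hence \<open>norm (T x) \<ge> m * norm x\<close> for all \<open>x\<close> forces \<open>m \<le> \<mu>\<close>. The proof
  never forms the operator \<open>T\<close>: it uses the limit quadratic form only, and compares it
  with \<open>T J\<close> by a second application of Cauchy--Schwarz, to the tail over \<open>I - J\<close>
  (\<open>norm_partial_frame_operator_le\<close>, \<open>frame_lower_bound_of_partial_operators\<close>).

  Adjoints are given by a definite description, so everything rests on their existence, which
  comes from the Riesz representation theorem.
\<close>

section \<open>Riesz representation and adjoints\<close>

text \<open>
  The representing vector is the minimiser of the strictly convex function
  \<open>(norm x)\<^sup>2 / 2 - f x\<close>. The parallelogram law makes every minimising sequence Cauchy, and the
  vanishing of the derivative at the minimum in every direction is the representation of \<open>f\<close>.
\<close>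

lemma Riesz_representation:
  fixes f :: "'a::{real_inner,complete_space} \<Rightarrow> real"
  assumes "bounded_linear f"
  shows "\<exists>z. \<forall>x. f x = inner x z"
proof -
  interpret f: bounded_linear f by fact
  obtain K where K: "\<And>x. norm (f x) \<le> norm x * K" using f.bounded by blast
  define \<phi> where "\<phi> x = (norm x)\<^sup>2 / 2 - f x" for x
  have "- (K\<^sup>2 / 2) \<le> \<phi> x" for x
  proof -
    have "0 \<le> (norm x - K)\<^sup>2" by simp
    then show ?thesis
      using K[of x] unfolding \<phi>_def by (simp add: power2_eq_square algebra_simps abs_le_iff)
  qed
  then have bdd: "bdd_below (range \<phi>)" by (auto intro!: bdd_belowI2)
  define m where "m = (INF x. \<phi> x)"
  have m_le: "m \<le> \<phi> x" for x
    unfolding m_def by (rule cINF_lower[OF bdd]) simp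
  have "\<exists>x. \<phi> x < m + 1 / Suc n" for n
    using cINF_less_iff[of UNIV \<phi> "m + 1 / Suc n"] bdd unfolding m_def by simp
  then obtain X where X: "\<And>n. \<phi> (X n) < m + 1 / Suc n" by metis
  have parallelogram: "(norm (x - y))\<^sup>2 = 4 * (\<phi> x + \<phi> y - 2 * \<phi> ((1/2) *\<^sub>R (x + y)))" for x y
    unfolding \<phi>_def
    by (simp add: power2_norm_eq_inner inner_simps f.add f.scaleR inner_commute field_simps)
  have "Cauchy X"
  proof (rule metric_CauchyI)
    fix e :: real assume "0 < e"
    then obtain N where N: "8 / e\<^sup>2 < real N" using reals_Archimedean2 by blast
    show "\<exists>M. \<forall>i\<ge>M. \<forall>j\<ge>M. dist (X i) (X j) < e"
    proof (intro exI allI impI)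
      fix i j assume ij: "N \<le> i" "N \<le> j"
      have small: "\<phi> (X n) < m + e\<^sup>2 / 8" if "N \<le> n" for n
      proof -
        have "8 / e\<^sup>2 < real (Suc n)" using N that by simp
        then have "1 / real (Suc n) < e\<^sup>2 / 8" using \<open>0 < e\<close> by (simp add: field_simps)
        then show ?thesis using X[of n] by linarith
      qed
      have "(norm (X i - X j))\<^sup>2 = 4 * (\<phi> (X i) + \<phi> (X j) - 2 * \<phi> ((1/2) *\<^sub>R (X i + X j)))"
        by (rule parallelogram)
      also have "\<dots> < 4 * ((m + e\<^sup>2 / 8) + (m + e\<^sup>2 / 8) - 2 * m)"
        using add_strict_mono[OF small[OF ij(1)] small[OF ij(2)]]
          m_le[of "(1/2) *\<^sub>R (X i + X j)"] by (simp only: mult_less_cancel_left_pos zero_less_numeral)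
      finally have "(norm (X i - X j))\<^sup>2 < e\<^sup>2" by (simp add: field_simps)
      then show "dist (X i) (X j) < e"
        using \<open>0 < e\<close> by (simp add: dist_norm power_less_imp_less_base)
    qed
  qed
  then obtain z where z: "X \<longlonglongrightarrow> z" using Cauchy_convergent convergent_def by blast
  have "(\<lambda>n. \<phi> (X n)) \<longlonglongrightarrow> \<phi> z"
    unfolding \<phi>_def by (intro tendsto_intros f.tendsto z) simp
  moreover have "(\<lambda>n. m + 1 / real (Suc n)) \<longlonglongrightarrow> m + 0"
    by (intro tendsto_add tendsto_const lim_1_over_n[THEN LIMSEQ_Suc])
  ultimately have "\<phi> z \<le> m + 0"
    by (rule LIMSEQ_le) (use X less_imp_le in blast)
  then have min: "\<phi> z \<le> \<phi> y" for y using m_le[of y] by simp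
  have "f y = inner y z" for y
  proof -
    define d where "d = f y - inner y z"
    have quad: "0 \<le> t\<^sup>2 * inner y y / 2 - t * d" for t
      using min[of "z + t *\<^sub>R y"] unfolding \<phi>_def d_def power2_norm_eq_inner
      by (simp add: inner_simps f.add f.scaleR inner_commute
          power2_eq_square field_simps)
    \<comment> \<open>The parabola is nonnegative and vanishes at 0, so its slope there is 0; the parameter
      \<open>d / (1 + inner y y)\<close> would make it negative otherwise, also for \<open>y = 0\<close>.\<close>
    define s where "s = 1 + inner y y"
    have s: "0 < s" "inner y y = s - 1" unfolding s_def using inner_ge_zero[of y] by (linarith, simp)
    have "0 \<le> (d / s)\<^sup>2 * (s - 1) / 2 - (d / s) * d" using quad[of "d / s"] s by simp
    also have "\<dots> = - (d\<^sup>2 * (s + 1) / (2 * s\<^sup>2))"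
      using s(1) by (simp add: field_simps power2_eq_square)
    finally have "d\<^sup>2 * (s + 1) \<le> 0" using s(1) by (simp add: field_simps zero_le_divide_iff divide_le_0_iff)
    then have "d = 0" using s(1) by (simp add: mult_le_0_iff)
    then show ?thesis by (simp add: d_def)
  qed
  then show ?thesis by blast
qed

text \<open>
  The real adjoint of a complex-linear operator is already its complex adjoint, because the
  imaginary part of \<open>cinner x y\<close> is minus the real inner product of \<open>\<i> *\<^sub>C x\<close> with \<open>y\<close>. All later
  arguments therefore use real inner products only.
\<close>

lemma inner_cadjoint:
  fixes T :: "'a::separable_hilbert \<Rightarrow> 'b::complex_inner"
  assumes T: "bounded_clinear T"
  shows "inner x (cadjoint T y) = inner (T x) y"
proof -
  have bl: "bounded_linear T" and sc: "\<And>a x. T (a *\<^sub>C x) = a *\<^sub>C T x"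
    using T by (auto simp: bounded_clinear_def)
  have "\<exists>z. \<forall>x. inner (T x) y = inner x z" for y
    by (intro Riesz_representation bounded_linear_compose[OF bounded_linear_inner_left bl])
  then obtain F where F: "\<And>x y. inner (T x) y = inner x (F y)" by metis
  have adj: "cinner (T x) y = cinner x (F y)" for x y
    by (rule complex_eqI) (simp_all add: Im_cinner F flip: inner_eq_Re_cinner sc)
  have "cadjoint T = F"
    unfolding cadjoint_def
  proof (rule the_equality)
    show "\<forall>x y. cinner (T x) y = cinner x (F y)" using adj by blast
  next
    fix F' assume "\<forall>x y. cinner (T x) y = cinner x (F' y)"
    then have "inner x (F' y) = inner x (F y)" for x y
      by (simp add: inner_eq_Re_cinner flip: adj)
    then show "F' = F" by (intro ext) (metis vector_eq_rdot inner_commute)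
  qed
  then show ?thesis by (simp add: F)
qed

section \<open>Cauchy--Schwarz for semidefinite forms\<close>

lemma psd_form_Cauchy_Schwarz:
  fixes b :: "'a::real_vector \<Rightarrow> 'a \<Rightarrow> real"
  assumes b: "bilinear b" and sym: "\<And>x y. b x y = b y x" and nonneg: "\<And>x. 0 \<le> b x x"
  shows "\<bar>b x y\<bar> \<le> sqrt (b x x) * sqrt (b y y)"
proof -
  have quad: "0 \<le> s\<^sup>2 * b x x + 2 * s * t * b x y + t\<^sup>2 * b y y" for s t
    using nonneg[of "s *\<^sub>R x + t *\<^sub>R y"] sym[of y x]
    by (simp add: bilinear_ladd[OF b] bilinear_radd[OF b] bilinear_lmul[OF b] bilinear_rmul[OF b]
        power2_eq_square algebra_simps)
  have "(b x y)\<^sup>2 \<le> b x x * b y y"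
  proof (cases "b y y = 0")
    case True
    have "b x y = 0"
    proof (rule ccontr)
      assume "b x y \<noteq> 0"
      \<comment> \<open>with these coefficients the form would take the value \<open>-1\<close>\<close>
      then show False
        using quad[of 1 "- (b x x + 1) / (2 * b x y)"] True by (simp add: field_simps)
    qed
    then show ?thesis using True by simp
  next
    case False
    then have "0 < b y y" using nonneg[of y] by simp
    moreover have "0 \<le> b y y * (b x x * b y y - (b x y)\<^sup>2)"
      using quad[of "b y y" "- b x y"] by (simp add: power2_eq_square algebra_simps)
    ultimately show ?thesis by (simp add: zero_le_mult_iff)
  qed
  then show ?thesis
    by (metis real_sqrt_abs real_sqrt_le_iff real_sqrt_mult)
qed

section \<open>Inequalities for real powers\<close>

text \<open>
  For \<open>k \<ge> 1\<close> this is superadditivity of \<open>z powr k\<close>, obtained by splitting off one factor \<open>z\<close> and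
  enlarging the base of the other; for \<open>k < 1\<close> it is midpoint concavity, obtained from convexity
  of the inverse function \<open>z powr (1 / k)\<close>.
\<close>

lemma powr_sum_le:
  fixes X Y k :: real
  assumes "0 \<le> X" "0 \<le> Y" "0 < k"
  shows "X powr k + Y powr k \<le> (if k \<ge> 1 then 1 else 2 powr (1 - k)) * (X + Y) powr k"
proof (cases "k \<ge> 1")
  case True
  have split: "Z powr k = Z * Z powr (k - 1)" if "0 \<le> Z" for Z :: real
    using that by (cases "Z = 0") (auto simp: powr_diff)
  have "X * X powr (k - 1) \<le> X * (X + Y) powr (k - 1)"
       "Y * Y powr (k - 1) \<le> Y * (X + Y) powr (k - 1)"
    using assms True by (auto intro!: mult_left_mono powr_mono2)
  then show ?thesis
    using True assms split[of X] split[of Y] split[of "X + Y"] by (simp add: distrib_right)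
next
  case False
  have c: "1 \<le> 2 powr (1 - k)" using False by (simp add: ge_one_powr_ge_zero)
  show ?thesis
  proof (cases "X = 0 \<or> Y = 0")
    case True
    then show ?thesis
      using False c mult_right_mono[OF c, of "(X + Y) powr k"] by auto
  next
    case pos: False
    have "((X powr k + Y powr k) / 2) powr (1 / k) \<le> (X + Y) / 2"
      using convex_onD[OF powr_convex[of "1 / k"], of "1/2" "X powr k" "Y powr k"] assms False pos
      by (simp add: powr_powr add_divide_distrib)
    then have "(((X powr k + Y powr k) / 2) powr (1 / k)) powr k \<le> ((X + Y) / 2) powr k"
      using assms by (intro powr_mono2) auto
    then have "(X powr k + Y powr k) / 2 \<le> (X + Y) powr k / 2 powr k"
      using assms by (simp add: powr_powr powr_divide)
    then show ?thesis
      using False by (simp add: powr_diff field_simps)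
  qed
qed

lemma powr_root_le:
  fixes u s t l1 l2 k :: real
  defines "c \<equiv> if k \<ge> 1 then 1 else 2 powr (1 - k)"
  assumes nonneg: "0 \<le> u" "0 \<le> s" "0 \<le> t" "0 \<le> l1" "0 \<le> l2" and k: "0 < k"
    and le: "u powr k \<le> l1 * s powr k + l2 * t powr k"
  shows "u \<le> c powr (1 / k) * l1 powr (1 / k) * s + c powr (1 / k) * l2 powr (1 / k) * t"
proof -
  define X Y where "X = l1 powr (1 / k) * s" and "Y = l2 powr (1 / k) * t"
  have XY: "0 \<le> X" "0 \<le> Y" unfolding X_def Y_def using nonneg by auto
  have "X powr k = l1 * s powr k" "Y powr k = l2 * t powr k"
    unfolding X_def Y_def using nonneg k by (simp_all add: powr_mult powr_powr)
  then have "u powr k \<le> c * (X + Y) powr k"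
    using le powr_sum_le[OF XY k] by (simp add: c_def)
  also have "\<dots> = (c powr (1 / k) * (X + Y)) powr k"
    using XY k by (simp add: powr_mult powr_powr c_def)
  finally have "u powr k \<le> (c powr (1 / k) * (X + Y)) powr k" .
  moreover have "0 \<le> c powr (1 / k) * (X + Y)" using XY by simp
  ultimately have "u \<le> c powr (1 / k) * (X + Y)"
    using powr_less_mono2[OF k, of "c powr (1 / k) * (X + Y)" u] by linarith
  then show ?thesis by (simp add: X_def Y_def algebra_simps)
qed

section \<open>The quadratic form of a Bessel family\<close>

text \<open>
  The bilinear form \<open>inner (T x) y\<close> of the frame operator \<open>T\<close>, written so that it makes sense
  without convergence of the series that defines \<open>T\<close>.
\<close>

definition frame_form :: "'i set \<Rightarrow> ('i \<Rightarrow> 'a \<Rightarrow> 'b::real_inner) \<Rightarrow> 'a \<Rightarrow> 'a \<Rightarrow> real"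
  where "frame_form I L x y = (\<Sum>\<^sub>\<infinity>i\<in>I. inner (L i x) (L i y))"

lemma summable_inner:
  fixes f g :: "'i \<Rightarrow> 'b::real_inner"
  assumes "(\<lambda>i. (norm (f i))\<^sup>2) summable_on I" "(\<lambda>i. (norm (g i))\<^sup>2) summable_on I"
  shows "(\<lambda>i. inner (f i) (g i)) summable_on I"
proof -
  have "norm (inner (f i) (g i)) \<le> (norm (f i))\<^sup>2 + (norm (g i))\<^sup>2" for i
  proof -
    have "norm (inner (f i) (g i)) \<le> norm (f i) * norm (g i)"
      by (simp add: Cauchy_Schwarz_ineq2)
    also have "\<dots> \<le> 2 * norm (f i) * norm (g i)" by simp
    finally show ?thesis using sum_squares_bound[of "norm (f i)" "norm (g i)"] by linarith
  qed
  then have "(\<lambda>i. norm (inner (f i) (g i))) summable_on I"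
    by (intro summable_on_comparison_test[OF summable_on_add[OF assms]]) auto
  then show ?thesis by (rule abs_summable_summable)
qed

lemma frame_form_commute: "frame_form I L x y = frame_form I L y x"
  by (simp add: frame_form_def inner_commute)

lemma frame_form_self: "frame_form I L x x = (\<Sum>\<^sub>\<infinity>i\<in>I. (norm (L i x))\<^sup>2)"
  by (simp add: frame_form_def power2_norm_eq_inner)

lemma frame_form_self_nonneg: "0 \<le> frame_form I L x x"
  unfolding frame_form_self by (intro infsum_nonneg) auto

lemma bilinear_frame_form:
  fixes L :: "'i \<Rightarrow> 'a::real_vector \<Rightarrow> 'b::real_inner"
  assumes "\<And>i. i \<in> I \<Longrightarrow> linear (L i)" and S: "\<And>x. (\<lambda>i. (norm (L i x))\<^sup>2) summable_on I"
  shows "bilinear (frame_form I L)"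
proof -
  have add: "frame_form I L (x + y) z = frame_form I L x z + frame_form I L y z" for x y z
    unfolding frame_form_def
    by (subst infsum_add[symmetric, OF summable_inner[OF S S] summable_inner[OF S S]])
      (auto intro!: infsum_cong simp: linear_add[OF assms(1)] inner_add_left)
  have scale: "frame_form I L (r *\<^sub>R x) z = r * frame_form I L x z" for r x z
    unfolding frame_form_def
    by (subst infsum_cmult_right'[symmetric])
      (auto intro!: infsum_cong simp: linear_scale[OF assms(1)])
  show ?thesis
    unfolding bilinear_def
    by (auto intro!: linearI simp: add scale frame_form_commute[of I L _ "_ + _"]
        frame_form_commute[of I L _ "_ *\<^sub>R _"]) (simp_all add: frame_form_commute)
qed

text \<open>
  A bound for the vector \<open>y = (\<Sum>i\<in>J. F i (L i x))\<close> in terms of values of the quadratic form at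
  \<open>x\<close> alone. Testing against \<open>y\<close> itself, \<open>(norm y)\<^sup>2\<close> is the full form at \<open>x, y\<close> minus its tail
  over \<open>I - J\<close>. Splitting the full form into \<open>\<mu> * inner x y\<close> and the semidefinite remainder \<open>P\<close>,
  Cauchy--Schwarz for \<open>P\<close> and for the tail gives the second and third summand. The bound serves
  twice: with \<open>J = I\<close> and \<open>\<mu> = 0\<close> it says that the operator of a finite Bessel family is bounded
  by \<open>M\<close>; with \<open>\<mu>\<close> the infimum of the form on the unit sphere it says that a unit
  vector where the form is nearly \<open>\<mu>\<close> has an image of norm at most nearly \<open>\<mu>\<close>, for large \<open>J\<close>.
\<close>

lemma norm_partial_frame_operator_le:
  fixes L :: "'i \<Rightarrow> 'a::real_inner \<Rightarrow> 'b::real_inner"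
  assumes lin: "\<And>i. i \<in> I \<Longrightarrow> linear (L i)"
    and adj: "\<And>i x y. i \<in> I \<Longrightarrow> inner x (F i y) = inner (L i x) y"
    and S: "\<And>x. (\<lambda>i. (norm (L i x))\<^sup>2) summable_on I"
    and lower: "\<And>y. \<mu> * (norm y)\<^sup>2 \<le> frame_form I L y y"
    and upper: "\<And>y. frame_form I L y y \<le> M * (norm y)\<^sup>2"
    and "0 \<le> \<mu>" "0 \<le> M" "finite J" "J \<subseteq> I"
  shows "norm (\<Sum>i\<in>J. F i (L i x)) \<le> \<mu> * norm x + sqrt (M * (frame_form I L x x - \<mu> * (norm x)\<^sup>2))
           + sqrt (M * (frame_form I L x x - (\<Sum>i\<in>J. (norm (L i x))\<^sup>2)))"
    (is "_ \<le> ?R")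
proof -
  define y where "y = (\<Sum>i\<in>J. F i (L i x))"
  define P where "P u v = frame_form I L u v - \<mu> * inner u v" for u v
  have bil: "bilinear (frame_form I L)" by (rule bilinear_frame_form[OF lin S])
  have SJ: "(\<lambda>i. (norm (L i x))\<^sup>2) summable_on (I - J)" for x
    by (rule summable_on_subset_banach[OF S]) auto
  have bilJ: "bilinear (frame_form (I - J) L)" by (rule bilinear_frame_form[OF lin SJ]) auto
  have bilP: "bilinear P"
    unfolding bilinear_def P_def
    by (auto intro!: linearI simp: bilinear_ladd[OF bil] bilinear_radd[OF bil] bilinear_lmul[OF bil]
        bilinear_rmul[OF bil] inner_simps algebra_simps)
  have split: "frame_form I L u v = (\<Sum>i\<in>J. inner (L i u) (L i v)) + frame_form (I - J) L u v" for u v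
  proof -
    have "I = J \<union> (I - J)" using \<open>J \<subseteq> I\<close> by auto
    then show ?thesis
      unfolding frame_form_def using \<open>finite J\<close>
      by (subst \<open>I = _\<close>, subst infsum_Un_disjoint) (auto intro: summable_inner SJ)
  qed
  have tail_x: "frame_form (I - J) L x x = frame_form I L x x - (\<Sum>i\<in>J. (norm (L i x))\<^sup>2)"
    using split[of x x] by (simp add: power2_norm_eq_inner)
  have tail_y: "frame_form (I - J) L y y \<le> M * (norm y)\<^sup>2"
  proof -
    have "0 \<le> (\<Sum>i\<in>J. inner (L i y) (L i y))" by (intro sum_nonneg) auto
    then show ?thesis using split[of y y] upper[of y] by linarith
  qed
  have P_y: "P y y \<le> M * (norm y)\<^sup>2"
  proof -
    have "0 \<le> \<mu> * inner y y" using \<open>0 \<le> \<mu>\<close> by simp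
    then show ?thesis using upper[of y] unfolding P_def by linarith
  qed
  have P_nonneg: "0 \<le> P u u" for u
    using lower[of u] by (simp add: P_def power2_norm_eq_inner)
  have "\<bar>P x y\<bar> \<le> sqrt (P x x) * sqrt (P y y)"
    by (rule psd_form_Cauchy_Schwarz[OF bilP _ P_nonneg])
      (simp add: P_def frame_form_commute inner_commute)
  also have "\<dots> \<le> sqrt (P x x) * sqrt (M * (norm y)\<^sup>2)"
    using P_nonneg P_y by (intro mult_left_mono real_sqrt_le_mono) auto
  finally have main: "P x y \<le> sqrt (M * P x x) * norm y"
    by (simp add: real_sqrt_mult mult_ac)
  have "\<bar>frame_form (I - J) L x y\<bar> \<le> sqrt (frame_form (I - J) L x x) * sqrt (frame_form (I - J) L y y)"
    by (rule psd_form_Cauchy_Schwarz[OF bilJ frame_form_commute frame_form_self_nonneg])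
  also have "\<dots> \<le> sqrt (frame_form (I - J) L x x) * sqrt (M * (norm y)\<^sup>2)"
    using tail_y by (intro mult_left_mono real_sqrt_le_mono) (auto simp: frame_form_self_nonneg)
  finally have tail: "- frame_form (I - J) L x y \<le> sqrt (M * frame_form (I - J) L x x) * norm y"
    by (simp add: real_sqrt_mult mult_ac)
  have "norm y * norm y = inner y (\<Sum>i\<in>J. F i (L i x))"
    unfolding y_def[symmetric] by (simp add: power2_norm_eq_inner flip: power2_eq_square)
  also have "\<dots> = (\<Sum>i\<in>J. inner (L i x) (L i y))"
    using \<open>J \<subseteq> I\<close> by (auto simp: inner_sum_right adj subsetD inner_commute intro!: sum.cong)
  also have "\<dots> = \<mu> * inner x y + P x y - frame_form (I - J) L x y"
    unfolding P_def split[of x y] by simp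
  also have "\<dots> \<le> \<mu> * (norm x * norm y) + sqrt (M * P x x) * norm y
      + sqrt (M * frame_form (I - J) L x x) * norm y"
    using main tail mult_left_mono[OF norm_cauchy_schwarz[of x y] \<open>0 \<le> \<mu>\<close>] by linarith
  also have "\<dots> = ?R * norm y"
    unfolding tail_x P_def power2_norm_eq_inner by (simp add: algebra_simps)
  finally have le: "norm y * norm y \<le> ?R * norm y" .
  have "0 \<le> ?R"
    using P_nonneg[of x] frame_form_self_nonneg[of "I - J" L x] \<open>0 \<le> \<mu>\<close> \<open>0 \<le> M\<close>
    unfolding tail_x P_def power2_norm_eq_inner by (intro add_nonneg_nonneg) auto
  then have "norm y \<le> ?R"
    using le by (cases "y = 0") (auto simp: mult_le_cancel_right)
  then show ?thesis by (simp add: y_def)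
qed

text \<open>
  Let \<open>\<mu>\<close> be the infimum of the form on the unit sphere. At a unit vector \<open>x\<close> where the form is
  below \<open>\<mu> + e\<close>, the preceding bound gives
  \<open>(\<Sum>i\<in>J. g i x) \<le> \<mu> + sqrt (M * e) + o(1)\<close> as \<open>J\<close> exhausts \<open>I\<close>. In the limit
  \<open>m \<le> \<mu> + sqrt (M * e)\<close>, and \<open>e\<close> was arbitrary. The summands \<open>g\<close> will be
  \<open>p * (norm (G i x))\<^sup>2\<close>, so that the frame \<open>G\<close> supplies \<open>m = A * p\<close>.
\<close>

lemma frame_lower_bound_of_partial_operators:
  fixes L :: "'i \<Rightarrow> 'a::real_inner \<Rightarrow> 'b::real_inner" and g :: "'i \<Rightarrow> 'a \<Rightarrow> real"
  assumes lin: "\<And>i. i \<in> I \<Longrightarrow> linear (L i)"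
    and adj: "\<And>i x y. i \<in> I \<Longrightarrow> inner x (F i y) = inner (L i x) y"
    and sq: "\<And>x. (\<lambda>i. (norm (L i x))\<^sup>2) summable_on I"
    and upper: "\<And>y. frame_form I L y y \<le> M * (norm y)\<^sup>2" and "0 \<le> M"
    and g: "\<And>x. (\<lambda>i. g i x) summable_on I" "\<And>x. m * (norm x)\<^sup>2 \<le> (\<Sum>\<^sub>\<infinity>i\<in>I. g i x)"
    and le: "\<And>J x. finite J \<Longrightarrow> J \<subseteq> I \<Longrightarrow> (\<Sum>i\<in>J. g i x) \<le> norm x * norm (\<Sum>i\<in>J. F i (L i x))"
  shows "m * (norm x)\<^sup>2 \<le> frame_form I L x x"
proof -
  define Values where "Values = (\<lambda>x. frame_form I L x x) ` {x. norm x = 1}"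
  define \<mu> where "\<mu> = Inf Values"
  have bil: "bilinear (frame_form I L)" by (rule bilinear_frame_form[OF lin sq])
  have bdd: "bdd_below Values" unfolding Values_def by (auto intro!: bdd_belowI2 frame_form_self_nonneg)
  have unit: "frame_form I L x x = (norm x)\<^sup>2 * frame_form I L (sgn x) (sgn x)" for x
  proof -
    have "frame_form I L (norm x *\<^sub>R sgn x) (norm x *\<^sub>R sgn x) = (norm x)\<^sup>2 * frame_form I L (sgn x) (sgn x)"
      by (simp only: bilinear_lmul[OF bil] bilinear_rmul[OF bil] real_scaleR_def power2_eq_square mult.assoc)
    moreover have "norm x *\<^sub>R sgn x = x" by (cases "x = 0") (simp_all add: sgn_div_norm)
    ultimately show ?thesis by simp
  qed
  \<comment> \<open>If the space is trivial, \<open>Values\<close> is empty and \<open>\<mu>\<close> is unspecified, but then only \<open>x = 0\<close> occurs.\<close>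
  have \<mu>_le: "\<mu> * (norm x)\<^sup>2 \<le> frame_form I L x x" for x
  proof (cases "x = 0")
    case False
    then have "\<mu> \<le> frame_form I L (sgn x) (sgn x)"
      unfolding \<mu>_def by (intro cInf_lower bdd) (auto simp: Values_def norm_sgn)
    then show ?thesis using unit[of x] by (simp add: mult_left_mono mult.commute[of \<mu>])
  qed (simp add: frame_form_self_nonneg)
  have m_le: "m \<le> \<mu>" if ne: "Values \<noteq> {}"
  proof -
    have "0 \<le> \<mu>"
      unfolding \<mu>_def using ne by (intro cInf_greatest) (auto simp: Values_def frame_form_self_nonneg)
    have bound: "m \<le> \<mu> + sqrt (M * e)" if "0 < e" for e
    proof -
      obtain x where x: "norm x = 1" "frame_form I L x x < \<mu> + e"
        using cInf_lessD[OF ne, of "\<mu> + e"] \<open>0 < e\<close> unfolding \<mu>_def[symmetric] by (auto simp: Values_def)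
      \<comment> \<open>At this \<open>x\<close> the second term of the operator bound is controlled by \<open>e\<close>, and the third is
        a tail that vanishes as \<open>J\<close> exhausts \<open>I\<close>.\<close>
      define R where "R J = \<mu> + sqrt (M * e)
          + sqrt (M * (frame_form I L x x - (\<Sum>i\<in>J. (norm (L i x))\<^sup>2)))" for J
      have "(\<Sum>i\<in>J. g i x) \<le> R J" if J: "finite J" "J \<subseteq> I" for J
      proof -
        have "sqrt (M * (frame_form I L x x - \<mu>)) \<le> sqrt (M * e)"
          using x(2) \<open>0 \<le> M\<close> by (intro real_sqrt_le_mono mult_left_mono) auto
        moreover have "(\<Sum>i\<in>J. g i x) \<le> norm (\<Sum>i\<in>J. F i (L i x))"
          using le[OF J, of x] x(1) by simp
        moreover have "norm (\<Sum>i\<in>J. F i (L i x)) \<le> \<mu> + sqrt (M * (frame_form I L x x - \<mu>))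
            + sqrt (M * (frame_form I L x x - (\<Sum>i\<in>J. (norm (L i x))\<^sup>2)))"
          using norm_partial_frame_operator_le[OF lin adj sq \<mu>_le upper \<open>0 \<le> \<mu>\<close> \<open>0 \<le> M\<close> J, of x] x(1)
          by simp
        ultimately show ?thesis unfolding R_def by linarith
      qed
      then have ev: "eventually (\<lambda>J. (\<Sum>i\<in>J. g i x) \<le> R J) (finite_subsets_at_top I)"
        by (intro eventually_finite_subsets_at_top_weakI)
      have lim: "((\<lambda>J. \<Sum>i\<in>J. (norm (L i x))\<^sup>2) \<longlongrightarrow> frame_form I L x x) (finite_subsets_at_top I)"
        unfolding frame_form_self by (intro infsum_tendsto sq)
      have "(R \<longlongrightarrow> \<mu> + sqrt (M * e) + sqrt (M * (frame_form I L x x - frame_form I L x x)))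
          (finite_subsets_at_top I)"
        unfolding R_def by (intro tendsto_intros lim)
      then have "(\<Sum>\<^sub>\<infinity>i\<in>I. g i x) \<le> \<mu> + sqrt (M * e) + sqrt (M * (frame_form I L x x - frame_form I L x x))"
        by (rule tendsto_le[OF finite_subsets_at_top_neq_bot _ infsum_tendsto[OF g(1)] ev])
      then show ?thesis using g(2)[of x] x(1) by simp
    qed
    have "((\<lambda>e. \<mu> + sqrt (M * e)) \<longlongrightarrow> \<mu> + sqrt (M * 0)) (at_right 0)"
      by (intro tendsto_intros)
    moreover have "eventually (\<lambda>e. m \<le> \<mu> + sqrt (M * e)) (at_right 0)"
      using bound by (auto simp: eventually_at_filter)
    ultimately show ?thesis
      using tendsto_lowerbound[of "\<lambda>e. \<mu> + sqrt (M * e)" _ "at_right 0" m] by simp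
  qed
  show ?thesis
  proof (cases "x = 0")
    case False
    then have "Values \<noteq> {}" by (auto simp: Values_def norm_sgn intro!: exI[of _ "sgn x"])
    then have "m * (norm x)\<^sup>2 \<le> \<mu> * (norm x)\<^sup>2"
      using m_le by (intro mult_right_mono) auto
    then show ?thesis using \<mu>_le[of x] by linarith
  qed (simp add: frame_form_self_nonneg)
qed

section \<open>Perturbation of Hilbert--Schmidt frames\<close>

text \<open>
  The case of linear estimates: the partial frame operators of \<open>G\<close> and \<open>H\<close> have comparable norms,
  and the comparison constants pass to the frame bounds.
\<close>

lemma hs_frame_perturbation:
  fixes G H :: "'i \<Rightarrow> 'h::separable_hilbert \<Rightarrow> 'k::separable_hilbert hs_op"
  assumes frame: "hs_frame I G A B" and H: "\<And>i. i \<in> I \<Longrightarrow> bounded_clinear (H i)"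
    and ab: "0 \<le> a" "a < 1" "0 \<le> b" "b < 1"
    and close: "\<And>J x. finite J \<Longrightarrow> J \<subseteq> I \<Longrightarrow>
      norm (\<Sum>i\<in>J. cadjoint (G i) (G i x) - cadjoint (H i) (H i x))
        \<le> a * norm (\<Sum>i\<in>J. cadjoint (G i) (G i x)) + b * norm (\<Sum>i\<in>J. cadjoint (H i) (H i x))"
  shows "hs_frame I H (A * ((1 - a) / (1 + b))) (B * ((1 + a) / (1 - b)))"
proof -
  define S T where "S J x = (\<Sum>i\<in>J. cadjoint (G i) (G i x))"
    and "T J x = (\<Sum>i\<in>J. cadjoint (H i) (H i x))" for J x
  define p q where "p = (1 - a) / (1 + b)" and "q = (1 + a) / (1 - b)"
  have G: "\<And>i. i \<in> I \<Longrightarrow> bounded_clinear (G i)" and "0 < A" "0 < B"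
    and sumG: "\<And>x. (\<lambda>i. (norm (G i x))\<^sup>2) summable_on I"
    and lowG: "\<And>x. A * (norm x)\<^sup>2 \<le> frame_form I G x x"
    and upG: "\<And>x. frame_form I G x x \<le> B * (norm x)\<^sup>2"
    using frame by (auto simp: hs_frame_def frame_form_self)
  have "0 < p" "0 < q" using ab by (auto simp: p_def q_def)
  have adj: "inner x (S J x) = (\<Sum>i\<in>J. (norm (G i x))\<^sup>2)"
            "inner x (T J x) = (\<Sum>i\<in>J. (norm (H i x))\<^sup>2)" if "J \<subseteq> I" for J x
    unfolding S_def T_def using that G H
    by (auto simp: inner_sum_right inner_cadjoint power2_norm_eq_inner subsetD intro!: sum.cong)
  have linG: "linear (G i)" if "i \<in> I" for i
    using G[OF that] by (auto simp: bounded_clinear_def intro: bounded_linear.linear)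
  have linH: "linear (H i)" if "i \<in> I" for i
    using H[OF that] by (auto simp: bounded_clinear_def intro: bounded_linear.linear)
  have norm_S: "norm (S J x) \<le> B * norm x" if J: "finite J" "J \<subseteq> I" for J x
  proof -
    have SJ: "\<And>x. (\<lambda>i. (norm (G i x))\<^sup>2) summable_on J" using J(1) by simp
    have upJ: "frame_form J G y y \<le> B * (norm y)\<^sup>2" for y
      unfolding frame_form_self using J sumG upG[of y]
      by (intro order_trans[OF _ upG, unfolded frame_form_self] infsum_mono2) auto
    have "norm (S J x) \<le> 0 * norm x + sqrt (B * (frame_form J G x x - 0 * (norm x)\<^sup>2))
        + sqrt (B * (frame_form J G x x - (\<Sum>i\<in>J. (norm (G i x))\<^sup>2)))"
      unfolding S_def
      using J \<open>0 < B\<close> linG G SJ upJ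
      by (intro norm_partial_frame_operator_le)
        (auto simp: frame_form_self_nonneg inner_cadjoint)
    also have "\<dots> = sqrt (B * frame_form J G x x)"
      using J(1) by (simp add: frame_form_self)
    also have "\<dots> \<le> sqrt (B * (B * (norm x)\<^sup>2))"
      using upJ \<open>0 < B\<close> by (intro real_sqrt_le_mono mult_left_mono) auto
    also have "\<dots> = B * norm x"
      using \<open>0 < B\<close> by (simp add: real_sqrt_mult flip: mult.assoc)
    finally show ?thesis .
  qed
  have comparison: "norm (T J x) \<le> q * norm (S J x)" "p * norm (S J x) \<le> norm (T J x)"
    if J: "finite J" "J \<subseteq> I" for J x
  proof -
    have *: "norm (S J x - T J x) \<le> a * norm (S J x) + b * norm (T J x)"
      using close[OF J, of x] by (simp add: S_def T_def sum_subtractf)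
    have "norm (T J x) * (1 - b) \<le> (1 + a) * norm (S J x)"
      using * norm_triangle_ineq3[of "S J x" "T J x"] by (simp add: algebra_simps)
    then show "norm (T J x) \<le> q * norm (S J x)" using ab by (simp add: q_def field_simps)
    have "(1 - a) * norm (S J x) \<le> norm (T J x) * (1 + b)"
      using * norm_triangle_ineq3[of "S J x" "T J x"] by (simp add: algebra_simps)
    then show "p * norm (S J x) \<le> norm (T J x)" using ab by (simp add: p_def field_simps)
  qed
  have fin_up: "(\<Sum>i\<in>J. (norm (H i x))\<^sup>2) \<le> B * q * (norm x)\<^sup>2" if J: "finite J" "J \<subseteq> I" for J x
  proof -
    have "(\<Sum>i\<in>J. (norm (H i x))\<^sup>2) \<le> norm x * norm (T J x)"
      unfolding adj(2)[OF J(2), symmetric] by (rule norm_cauchy_schwarz)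
    also have "\<dots> \<le> norm x * (q * (B * norm x))"
      using \<open>0 < q\<close>
      by (intro mult_left_mono order_trans[OF comparison(1)[OF J]] norm_S J) auto
    finally show ?thesis by (simp add: power2_eq_square mult_ac)
  qed
  have sumH: "(\<lambda>i. (norm (H i x))\<^sup>2) summable_on I" for x
    by (rule nonneg_bdd_above_summable_on) (auto intro!: bdd_aboveI2 fin_up)
  have upH: "frame_form I H x x \<le> B * q * (norm x)\<^sup>2" for x
    unfolding frame_form_self by (rule infsum_le_finite_sums[OF sumH fin_up])
  have lowH: "A * p * (norm x)\<^sup>2 \<le> frame_form I H x x" for x
  proof (rule frame_lower_bound_of_partial_operators[where g = "\<lambda>i x. p * (norm (G i x))\<^sup>2" and M = "B * q"
        and F = "\<lambda>i. cadjoint (H i)"])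
    show "A * p * (norm x)\<^sup>2 \<le> (\<Sum>\<^sub>\<infinity>i\<in>I. p * (norm (G i x))\<^sup>2)" for x
      using mult_left_mono[OF lowG[of x], of p] \<open>0 < p\<close>
      by (simp add: infsum_cmult_right' frame_form_self mult_ac)
    show "(\<Sum>i\<in>J. p * (norm (G i x))\<^sup>2) \<le> norm x * norm (\<Sum>i\<in>J. cadjoint (H i) (H i x))"
      if J: "finite J" "J \<subseteq> I" for J x
    proof -
      have "(\<Sum>i\<in>J. p * (norm (G i x))\<^sup>2) = p * inner x (S J x)"
        by (simp add: adj(1)[OF J(2)] sum_distrib_left)
      also have "\<dots> \<le> p * (norm x * norm (S J x))"
        using \<open>0 < p\<close> by (intro mult_left_mono norm_cauchy_schwarz) auto
      also have "\<dots> = norm x * (p * norm (S J x))" by simp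
      also have "\<dots> \<le> norm x * norm (T J x)"
        by (intro mult_left_mono comparison(2) J) auto
      finally show ?thesis by (simp add: T_def)
    qed
  qed (use linH H sumH upH sumG \<open>0 < B\<close> \<open>0 < q\<close> in
      \<open>auto simp: inner_cadjoint intro: summable_on_cmult_right\<close>)
  show ?thesis
    unfolding hs_frame_def p_def[symmetric] q_def[symmetric] frame_form_self[symmetric]
    using H sumH upH lowH \<open>0 < A\<close> \<open>0 < B\<close> \<open>0 < p\<close> \<open>0 < q\<close> by simp
qed

theorem theorem4p1:
  fixes I :: "'i set"
    and G H :: "'i \<Rightarrow> 'h::separable_hilbert \<Rightarrow> 'k::separable_hilbert hs_op"
    and A B :: real
    and lam1 lam2 :: "real \<Rightarrow> real"
  assumes "countable I"
    and "hs_frame I G A B"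
    and "\<forall>i\<in>I. bounded_clinear (H i)"
    and "\<forall>k>0. 0 \<le> lam1 k \<and> 0 \<le> lam2 k \<and> max (lam1 k) (lam2 k) < min 1 (2 powr (k - 1)) \<and>
      (\<forall>J x. finite J \<and> J \<subseteq> I \<longrightarrow>
        norm (\<Sum>i\<in>J. cadjoint (G i) (G i x) - cadjoint (H i) (H i x)) powr k
          \<le> lam1 k * norm (\<Sum>i\<in>J. cadjoint (G i) (G i x)) powr k
            + lam2 k * norm (\<Sum>i\<in>J. cadjoint (H i) (H i x)) powr k)"
  shows "(\<exists>A' B'. hs_frame I H A' B') \<and>
    (\<forall>k>0. let c = (if k \<ge> 1 then 1 else 2 powr (1 - k)) in
      hs_frame I H
        (A * ((1 - c powr (1 / k) * lam1 k powr (1 / k)) / (1 + c powr (1 / k) * lam2 k powr (1 / k))))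
        (B * ((1 + c powr (1 / k) * lam1 k powr (1 / k)) / (1 - c powr (1 / k) * lam2 k powr (1 / k)))))"
proof -
  have frame: "let c = (if k \<ge> 1 then 1 else 2 powr (1 - k)) in
      hs_frame I H
        (A * ((1 - c powr (1 / k) * lam1 k powr (1 / k)) / (1 + c powr (1 / k) * lam2 k powr (1 / k))))
        (B * ((1 + c powr (1 / k) * lam1 k powr (1 / k)) / (1 - c powr (1 / k) * lam2 k powr (1 / k))))"
    if "0 < k" for k
  proof -
    define c :: real where "c = (if k \<ge> 1 then 1 else 2 powr (1 - k))"
    have lam: "0 \<le> lam1 k" "0 \<le> lam2 k" "lam1 k < min 1 (2 powr (k - 1))" "lam2 k < min 1 (2 powr (k - 1))"
      using assms(4) \<open>0 < k\<close> by auto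
    have root_less: "c powr (1 / k) * l powr (1 / k) < 1" if "0 \<le> l" "l < min 1 (2 powr (k - 1))" for l
    proof -
      have "c * l < 1"
        using that by (auto simp: c_def powr_diff field_simps)
      then have "(c * l) powr (1 / k) < 1 powr (1 / k)"
        using that \<open>0 < k\<close> by (intro powr_less_mono2) (auto simp: c_def)
      then show ?thesis using that by (simp add: powr_mult c_def)
    qed
    have "hs_frame I H
        (A * ((1 - c powr (1 / k) * lam1 k powr (1 / k)) / (1 + c powr (1 / k) * lam2 k powr (1 / k))))
        (B * ((1 + c powr (1 / k) * lam1 k powr (1 / k)) / (1 - c powr (1 / k) * lam2 k powr (1 / k))))"
    proof (rule hs_frame_perturbation[OF assms(2)])
      show "norm (\<Sum>i\<in>J. cadjoint (G i) (G i x) - cadjoint (H i) (H i x))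
          \<le> c powr (1 / k) * lam1 k powr (1 / k) * norm (\<Sum>i\<in>J. cadjoint (G i) (G i x))
            + c powr (1 / k) * lam2 k powr (1 / k) * norm (\<Sum>i\<in>J. cadjoint (H i) (H i x))"
        if "finite J" "J \<subseteq> I" for J x
        unfolding c_def using assms(4) \<open>0 < k\<close> that lam by (intro powr_root_le) auto
    qed (use assms(3) root_less lam in auto)
    then show ?thesis by (simp add: c_def Let_def)
  qed
  show ?thesis
  proof (intro conjI allI impI)
    show "\<exists>A' B'. hs_frame I H A' B'" using frame[of 1] unfolding Let_def by auto
  qed (rule frame)
qed

end
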